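(* Let $d\in\{2,3\}$, let $D\subset\mathbb{R}^d$ be a bounded domain with Lipschitz boundary, let $T>0$, $I=(0,T)$, let $G\in\mathbb{R}^{d\times d}$ be invertible, and let $h:I\to\mathbb{R}^d$ be a trajectory (with time derivative $\dot h$) such that: (i) $C_h:=\sup_{t\in[0,T]}|\dot h(t)|^{-1}<\infty$; (ii) $G^{-1}h(t)\in D$ for every $t\in I$, and there is a number $N_h$ such that for every $x\in D$ there exist at most $N_h$ distinct $t\in I$ with $h(t)=Gx$. Let $f(x,t):=|Gx-h(t)|^{-\frac d2}$ for $(x,t)\in D\times I$, and let $\{\lambda_n\}_{n=1}^\infty$ be the eigenvalues of the operator $\mathcal{R}=\mathcal{S}^*\mathcal{S}$ on $L^2(D)$, counted with multiplicity and ordered nonincreasingly, where $\mathcal{S}$ is the integral operator with kernel $f$. Then for any $\epsilon>0$ there is a constant $C$ (independent of $n$) such that $\lambda_n\le C n^{-\frac12+\epsilon}$ as $n\to\infty$.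
   Context: $|\cdot|$ is the Euclidean norm. The operators are $(\mathcal{S}v)(t)=\int_D f(x,t)v(x)\,\mathrm{d}x$ and $(\mathcal{S}^*v)(x)=\int_I f(x,t)v(t)\,\mathrm{d}t$. The operator $\mathcal{R}=\mathcal{S}^*\mathcal{S}$ is the integral operator with kernel $R(x,x')=\int_I f(x,t)f(x',t)\,\mathrm{d}t$; it is nonnegative, compact and self-adjoint on $L^2(D)$.
   Formalization: The trajectory h is assumed continuously differentiable on I with its derivative extending continuously to [0,T]; with mere differentiability the claim fails, e.g. for unit-speed paths with ever tighter small spirals accumulating at t=0. *)

theory Defs
  imports "HOL-Analysis.Analysis"
begin

text \<open>
  Near every boundary point, in suitable orthonormal coordinates with last axis \<open>e\<close>, the set lies
  strictly above the graph of a Lipschitz function \<open>g\<close> on the hyperplane orthogonal to \<open>e\<close>.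
\<close>

definition lipschitz_boundary :: "'a::euclidean_space set \<Rightarrow> bool" where
  "lipschitz_boundary D \<longleftrightarrow>
     (\<forall>p\<in>frontier D. \<exists>U e g L. open U \<and> p \<in> U \<and> norm e = 1 \<and>
        L-lipschitz_on {y. e \<bullet> y = 0} (g :: 'a \<Rightarrow> real) \<and>
        D \<inter> U = {x \<in> U. g (x - (e \<bullet> x) *\<^sub>R e) < e \<bullet> x})"

definition bounded_lipschitz_domain :: "'a::euclidean_space set \<Rightarrow> bool" where
  "bounded_lipschitz_domain D \<longleftrightarrow>
     open D \<and> connected D \<and> D \<noteq> {} \<and> bounded D \<and> lipschitz_boundary D"

text \<open>
  Elements of \<open>L\<^sup>2(M)\<close> are represented by real-valued functions; equality in \<open>L\<^sup>2(M)\<close>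
  is equality almost everywhere.
\<close>

definition L2_space :: "'a measure \<Rightarrow> ('a \<Rightarrow> real) set" where
  "L2_space M = {v \<in> borel_measurable M. integrable M (\<lambda>x. (v x)\<^sup>2)}"

definition integral_op :: "'a measure \<Rightarrow> ('a \<Rightarrow> 'b \<Rightarrow> real) \<Rightarrow> ('a \<Rightarrow> real) \<Rightarrow> 'b \<Rightarrow> real" where
  "integral_op M k v = (\<lambda>y. \<integral>x. k x y * v x \<partial>M)"

definition forward_op ::
    "'a::euclidean_space set \<Rightarrow> ('a \<Rightarrow> real \<Rightarrow> real) \<Rightarrow> ('a \<Rightarrow> real) \<Rightarrow> real \<Rightarrow> real" where
  "forward_op D f = integral_op (lebesgue_on D) f"

definition adjoint_op ::
    "real set \<Rightarrow> ('a::euclidean_space \<Rightarrow> real \<Rightarrow> real) \<Rightarrow> (real \<Rightarrow> real) \<Rightarrow> 'a \<Rightarrow> real" where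
  "adjoint_op I f = integral_op (lebesgue_on I) (\<lambda>t x. f x t)"

definition normal_op ::
    "'a::euclidean_space set \<Rightarrow> real set \<Rightarrow> ('a \<Rightarrow> real \<Rightarrow> real) \<Rightarrow> ('a \<Rightarrow> real) \<Rightarrow> 'a \<Rightarrow> real" where
  "normal_op D I f = adjoint_op I f \<circ> forward_op D f"

definition L2_eigenspace ::
    "'a measure \<Rightarrow> (('a \<Rightarrow> real) \<Rightarrow> 'a \<Rightarrow> real) \<Rightarrow> real \<Rightarrow> ('a \<Rightarrow> real) set" where
  "L2_eigenspace M A \<mu> = {v \<in> L2_space M. AE x in M. A v x = \<mu> * v x}"

text \<open>
  \<open>V\<close>, taken modulo equality almost everywhere, has a basis \<open>e 0, \<dots>, e (m - 1)\<close>.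
\<close>

definition AE_dimension :: "'a measure \<Rightarrow> ('a \<Rightarrow> real) set \<Rightarrow> nat \<Rightarrow> bool" where
  "AE_dimension M V m \<longleftrightarrow>
     (\<exists>e :: nat \<Rightarrow> 'a \<Rightarrow> real.
        (\<forall>i<m. e i \<in> V) \<and>
        (\<forall>c :: nat \<Rightarrow> real. (AE x in M. (\<Sum>i<m. c i * e i x) = 0) \<longrightarrow> (\<forall>i<m. c i = 0)) \<and>
        (\<forall>v\<in>V. \<exists>c :: nat \<Rightarrow> real. AE x in M. v x = (\<Sum>i<m. c i * e i x)))"

text \<open>
  The eigenvalues of a nonnegative compact self-adjoint operator \<open>A\<close> on \<open>L\<^sup>2(M)\<close>, counted with
  multiplicity and listed nonincreasingly as \<open>lam 1, lam 2, \<dots>\<close> (the value \<open>lam 0\<close> is irrelevant).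
  Every \<open>\<mu> > 0\<close> is listed exactly as often as the dimension of its eigenspace (not at all if it is
  no eigenvalue). If there are infinitely many positive eigenvalues they fill the whole list;
  otherwise the list continues with the eigenvalue 0.
\<close>

definition eigenvalue_sequence ::
    "'a measure \<Rightarrow> (('a \<Rightarrow> real) \<Rightarrow> 'a \<Rightarrow> real) \<Rightarrow> (nat \<Rightarrow> real) \<Rightarrow> bool" where
  "eigenvalue_sequence M A lam \<longleftrightarrow>
     (\<forall>n\<ge>1. 0 \<le> lam n) \<and>
     (\<forall>m\<ge>1. \<forall>n\<ge>m. lam n \<le> lam m) \<and>
     (\<forall>\<mu>>0. finite {n. 1 \<le> n \<and> lam n = \<mu>} \<and>
        AE_dimension M (L2_eigenspace M A \<mu>) (card {n. 1 \<le> n \<and> lam n = \<mu>}))"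

text \<open>
  \<open>|G x - h t|\<^bsup>-d/2\<^esup>\<close>; on the null set where \<open>G x = h t\<close>, \<open>powr\<close> gives the value 0.
\<close>

definition singular_kernel ::
    "real ^ 'd ^ 'd \<Rightarrow> (real \<Rightarrow> real ^ 'd) \<Rightarrow> real ^ 'd \<Rightarrow> real \<Rightarrow> real" where
  "singular_kernel G h x t = norm (G *v x - h t) powr (- (real CARD('d) / 2))"

text \<open>
  \<open>h\<close> is continuously differentiable on \<open>(0,T)\<close>, and \<open>h'\<close> is its derivative there, extended
  continuously to \<open>[0,T]\<close>.
\<close>

definition trajectory ::
    "real \<Rightarrow> (real \<Rightarrow> 'a::euclidean_space) \<Rightarrow> (real \<Rightarrow> 'a) \<Rightarrow> bool" where
  "trajectory T h h' \<longleftrightarrow>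
     (\<forall>t\<in>{0<..<T}. (h has_vector_derivative h' t) (at t)) \<and> continuous_on {0..T} h'"

text \<open>
  The supremum of \<open>1 / |h' t|\<close> over \<open>[0,T]\<close>, in \<open>[0,\<infinity>]\<close>: in \<^typ>\<open>ennreal\<close> the inverse of 0
  is \<open>\<infinity>\<close>, so finiteness excludes zeros of \<open>h'\<close>.
\<close>

definition inverse_speed_sup :: "real \<Rightarrow> (real \<Rightarrow> 'a::euclidean_space) \<Rightarrow> ennreal" where
  "inverse_speed_sup T h' = (SUP t\<in>{0..T}. inverse (ennreal (norm (h' t))))"

end

theory Submission
  imports Defs
begin

text \<open>
  If \<open>u\<^sub>p\<close> are orthonormal eigenfunctions of \<open>R\<close> with eigenvalues \<open>\<mu>\<^sub>p\<close>, Bessel's inequality for the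
  functions \<open>R(x, \<cdot>)\<close> gives \<open>\<Sum>\<^sub>p \<mu>\<^sub>p\<^sup>2 \<le> \<integral>\<integral> R(x, x')\<^sup>2\<close>; as the eigenvalues are nonincreasing, square
  integrability of the kernel \<open>R\<close> already implies \<open>\<lambda>\<^sub>n = O(n\<^sup>-\<^sup>1\<^sup>/\<^sup>2)\<close>. By Tonelli,
  \<open>\<integral>\<integral> R(x, x')\<^sup>2 dx dx' = \<integral>\<integral> K(t, s)\<^sup>2 dt ds\<close> with \<open>K(t, s) = \<integral>\<^sub>D f(x, t) f(x, s) dx\<close>. At every \<open>x\<close> one of
  \<open>|G x - h t|\<close>, \<open>|G x - h s|\<close> is at least \<open>|h t - h s| / 2\<close>; trading a power 1/4 of it yields
  \<open>K(t, s) \<le> C |h t - h s|\<^sup>-\<^sup>1\<^sup>/\<^sup>4\<close>. Finally \<open>\<integral> |h t - y|\<^sup>-\<^sup>1\<^sup>/\<^sup>2 dt\<close> is bounded uniformly in \<open>y\<close>, because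
  \<open>h'\<close> is bounded away from 0 and hence \<open>h\<close> expands distances on all short time intervals.
\<close>

section \<open>Orthonormal systems\<close>

lemma L2_space_add:
  assumes "v \<in> L2_space M" "w \<in> L2_space M"
  shows "(\<lambda>x. v x + w x) \<in> L2_space M"
proof -
  have [measurable]: "v \<in> borel_measurable M" "w \<in> borel_measurable M"
    and i: "integrable M (\<lambda>x. (v x)\<^sup>2)" "integrable M (\<lambda>x. (w x)\<^sup>2)"
    using assms by (auto simp: L2_space_def)
  have "integrable M (\<lambda>x. (v x + w x)\<^sup>2)"
  proof (rule Bochner_Integration.integrable_bound)
    show "integrable M (\<lambda>x. 2 * (v x)\<^sup>2 + 2 * (w x)\<^sup>2)" using i by simp
    have "(v x + w x)\<^sup>2 \<le> 2 * (v x)\<^sup>2 + 2 * (w x)\<^sup>2" for x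
      using zero_le_power2[of "v x - w x"] by (simp add: power2_eq_square algebra_simps)
    then show "AE x in M. norm ((v x + w x)\<^sup>2) \<le> norm (2 * (v x)\<^sup>2 + 2 * (w x)\<^sup>2)"
      by (auto intro: order_trans)
  qed simp
  then show ?thesis by (simp add: L2_space_def)
qed

lemma L2_space_scale: "v \<in> L2_space M \<Longrightarrow> (\<lambda>x. c * v x) \<in> L2_space M"
  by (auto simp: L2_space_def power_mult_distrib)

lemma L2_space_sum:
  assumes "\<And>i. i \<in> I \<Longrightarrow> v i \<in> L2_space M"
  shows "(\<lambda>x. \<Sum>i\<in>I. c i * v i x) \<in> L2_space M"
  using assms
proof (induction I rule: infinite_finite_induct)
  case (insert i I)
  then show ?case
    by (simp add: L2_space_add L2_space_scale)
qed (auto simp: L2_space_def)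

lemma abs_mult_le_sum_sq: "\<bar>a * b\<bar> \<le> a\<^sup>2 + b\<^sup>2" for a b :: real
  using sum_squares_bound[of "\<bar>a\<bar>" "\<bar>b\<bar>"] mult_nonneg_nonneg[of "\<bar>a\<bar>" "\<bar>b\<bar>"]
  unfolding abs_mult power2_abs by linarith

lemma L2_space_mult_integrable:
  assumes "v \<in> L2_space M" "w \<in> L2_space M"
  shows "integrable M (\<lambda>x. v x * w x)"
proof (rule Bochner_Integration.integrable_bound)
  have [measurable]: "v \<in> borel_measurable M" "w \<in> borel_measurable M"
    and i: "integrable M (\<lambda>x. (v x)\<^sup>2)" "integrable M (\<lambda>x. (w x)\<^sup>2)"
    using assms by (auto simp: L2_space_def)
  show "integrable M (\<lambda>x. (v x)\<^sup>2 + (w x)\<^sup>2)" using i by simp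
  show "(\<lambda>x. v x * w x) \<in> borel_measurable M" by simp
  show "AE x in M. norm (v x * w x) \<le> norm ((v x)\<^sup>2 + (w x)\<^sup>2)"
    using abs_mult_le_sum_sq[of "v _" "w _"] by auto
qed

lemma integral_sum_mult:
  assumes "\<And>i. i \<in> I \<Longrightarrow> v i \<in> L2_space M" "w \<in> L2_space M"
  shows "(\<integral>x. (\<Sum>i\<in>I. c i * v i x) * w x \<partial>M) = (\<Sum>i\<in>I. c i * (\<integral>x. v i x * w x \<partial>M))"
proof -
  have "(\<integral>x. (\<Sum>i\<in>I. c i * v i x) * w x \<partial>M) = (\<integral>x. (\<Sum>i\<in>I. c i * (v i x * w x)) \<partial>M)"
    by (simp add: sum_distrib_right mult.assoc)
  also have "\<dots> = (\<Sum>i\<in>I. (\<integral>x. c i * (v i x * w x) \<partial>M))"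
    by (intro Bochner_Integration.integral_sum integrable_mult_right L2_space_mult_integrable assms)
  finally show ?thesis by simp
qed

text \<open>For the projection \<open>s\<close> of \<open>r\<close> onto the span of the
  \<open>u p\<close>, the integrals of \<open>s * r\<close> and of \<open>s * s\<close> both equal
  the sum of the squared coefficients \<open>a p\<close>. Expanding 0 \<le> \<integral> (r - s)^2
  then gives the inequality.\<close>

lemma bessel_inequality:
  assumes P: "finite P" and u: "\<And>p. p \<in> P \<Longrightarrow> u p \<in> L2_space M" and r: "r \<in> L2_space M"
    and on: "\<And>p q. p \<in> P \<Longrightarrow> q \<in> P \<Longrightarrow> (\<integral>x. u p x * u q x \<partial>M) = of_bool (p = q)"
  shows "(\<Sum>p\<in>P. (\<integral>x. r x * u p x \<partial>M)\<^sup>2) \<le> (\<integral>x. (r x)\<^sup>2 \<partial>M)"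
proof -
  define a where "a p = (\<integral>x. r x * u p x \<partial>M)" for p
  define s where "s x = (\<Sum>p\<in>P. a p * u p x)" for x
  have s: "s \<in> L2_space M"
    unfolding s_def[abs_def] by (intro L2_space_sum u)
  have sr: "(\<integral>x. s x * r x \<partial>M) = (\<Sum>p\<in>P. (a p)\<^sup>2)"
    unfolding s_def using integral_sum_mult[OF u r, where I = P and c = a]
    by (simp add: a_def power2_eq_square mult.commute[of _ "r _"])
  have us: "(\<integral>x. u p x * s x \<partial>M) = a p" if "p \<in> P" for p
  proof -
    have "(\<integral>x. u p x * s x \<partial>M) = (\<Sum>q\<in>P. a q * of_bool (q = p))"
      using integral_sum_mult[OF u u[OF that], where I = P and c = a] that
      by (simp add: s_def mult.commute[of "u p _"] on)
    then show ?thesis using that P by (simp add: of_bool_def if_distrib sum.If_cases Int_absorb1 cong: if_cong)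
  qed
  have ss: "(\<integral>x. s x * s x \<partial>M) = (\<Sum>p\<in>P. (a p)\<^sup>2)"
    using integral_sum_mult[of P u M s a] u s us by (simp add: s_def[symmetric] power2_eq_square)
  have "0 \<le> (\<integral>x. (r x - s x)\<^sup>2 \<partial>M)" by simp
  also have "\<dots> = (\<integral>x. (r x * r x - 2 * (s x * r x)) + s x * s x \<partial>M)"
    by (simp add: power2_eq_square algebra_simps)
  also have "\<dots> = (\<integral>x. r x * r x \<partial>M) - 2 * (\<integral>x. s x * r x \<partial>M) + (\<integral>x. s x * s x \<partial>M)"
    using L2_space_mult_integrable[OF r r] L2_space_mult_integrable[OF s r] L2_space_mult_integrable[OF s s]
    by simp
  finally show ?thesis
    unfolding sr ss a_def by (simp add: power2_eq_square)
qed

text \<open>Induction on \<open>m\<close>: subtract from \<open>e m\<close> its projection onto the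
  earlier \<open>u j\<close> and normalize. The conclusion records that each \<open>u i\<close> is a
  combination of the \<open>e j\<close>, because this is what later carries the eigenvalue equation
  over from \<open>e\<close> to \<open>u\<close>.\<close>

lemma gram_schmidt:
  fixes e :: "nat \<Rightarrow> 'a \<Rightarrow> real"
  assumes "\<And>i. i < m \<Longrightarrow> e i \<in> L2_space M"
    and "\<And>c :: nat \<Rightarrow> real. (AE x in M. (\<Sum>i<m. c i * e i x) = 0) \<Longrightarrow> \<forall>i<m. c i = 0"
  shows "\<exists>u :: nat \<Rightarrow> 'a \<Rightarrow> real. (\<forall>i<m. \<exists>c. u i = (\<lambda>x. \<Sum>j<m. c j * e j x)) \<and>
           (\<forall>i<m. \<forall>j<m. (\<integral>x. u i x * u j x \<partial>M) = of_bool (i = j))"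
  using assms
proof (induction m)
  case (Suc m)
  have indep: "\<forall>i<m. c i = 0" if c: "AE x in M. (\<Sum>i<m. c i * e i x) = 0" for c :: "nat \<Rightarrow> real"
  proof -
    \<comment> \<open>Padding a relation among the first \<open>m\<close> functions with the
      coefficient 0 turns it into a relation among all \<open>Suc m\<close>.\<close>
    have "\<forall>i<Suc m. (c(m := 0)) i = 0" using c by (intro Suc.prems(2)) simp
    then show ?thesis by (auto dest: less_SucI split: if_splits)
  qed
  have "\<exists>u. (\<forall>i<m. \<exists>c. u i = (\<lambda>x. \<Sum>j<m. c j * e j x)) \<and>
      (\<forall>i<m. \<forall>j<m. (\<integral>x. u i x * u j x \<partial>M) = of_bool (i = j))"
    by (intro Suc.IH Suc.prems(1) indep) auto
  then obtain u where uc: "\<And>i. i < m \<Longrightarrow> \<exists>c. u i = (\<lambda>x. \<Sum>j<m. c j * e j x)"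
    and on: "\<And>i j. i < m \<Longrightarrow> j < m \<Longrightarrow> (\<integral>x. u i x * u j x \<partial>M) = of_bool (i = j)"
    by blast
  from uc obtain C where C: "\<And>i. i < m \<Longrightarrow> u i = (\<lambda>x. \<Sum>j<m. C i j * e j x)" by metis
  have u: "u i \<in> L2_space M" if "i < m" for i
    unfolding C[OF that] using Suc.prems(1) by (intro L2_space_sum) auto
  have em: "e m \<in> L2_space M" using Suc.prems(1) by simp
  define a where "a j = (\<integral>x. e m x * u j x \<partial>M)" for j
  \<comment> \<open>These are the coefficients of \<open>w\<close> in terms of the
    \<open>e j\<close>. The entry 1 at \<open>m\<close> contradicts independence if \<open>w\<close>
    vanishes almost everywhere, which gives \<open>q \<noteq> 0\<close> below.\<close>
  define c where "c = (\<lambda>j. - (\<Sum>i<m. a i * C i j))(m := 1)"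
  define w where "w x = e m x - (\<Sum>j<m. a j * u j x)" for x
  have w_c: "w x = (\<Sum>j<Suc m. c j * e j x)" for x
  proof -
    have "(\<Sum>j<m. a j * u j x) = (\<Sum>i<m. \<Sum>j<m. a i * C i j * e j x)"
      by (simp add: C sum_distrib_left mult.assoc)
    also have "\<dots> = (\<Sum>j<m. \<Sum>i<m. a i * C i j * e j x)" by (rule sum.swap)
    finally show ?thesis
      by (simp add: w_def c_def sum_distrib_right sum_negf)
  qed
  have w: "w \<in> L2_space M"
    unfolding w_c[abs_def] using Suc.prems(1) by (intro L2_space_sum) auto
  have wu: "(\<integral>x. w x * u i x \<partial>M) = 0" if "i < m" for i
  proof -
    have "(\<integral>x. w x * u i x \<partial>M) = (\<integral>x. e m x * u i x - (\<Sum>j<m. a j * u j x) * u i x \<partial>M)"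
      by (simp add: w_def algebra_simps)
    also have "\<dots> = a i - (\<integral>x. (\<Sum>j<m. a j * u j x) * u i x \<partial>M)"
      unfolding a_def using u that em
      by (intro Bochner_Integration.integral_diff L2_space_mult_integrable L2_space_sum) auto
    also have "(\<integral>x. (\<Sum>j<m. a j * u j x) * u i x \<partial>M) = (\<Sum>j<m. a j * of_bool (j = i))"
      using u that by (subst integral_sum_mult) (auto simp: on)
    also have "\<dots> = a i" using that by (simp add: of_bool_def if_distrib sum.If_cases cong: if_cong)
    finally show ?thesis by simp
  qed
  define q where "q = (\<integral>x. w x * w x \<partial>M)"
  have "q \<noteq> 0"
  proof
    assume "q = 0"
    then have "AE x in M. w x * w x = 0"
      unfolding q_def using L2_space_mult_integrable[OF w w]
      by (subst (asm) integral_nonneg_eq_0_iff_AE) auto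
    then have "AE x in M. (\<Sum>j<Suc m. c j * e j x) = 0" by (simp add: w_c)
    from Suc.prems(2)[OF this] have "c m = 0" by blast
    then show False by (simp add: c_def)
  qed
  moreover have "q \<ge> 0" unfolding q_def by simp
  ultimately have q: "q > 0" by simp
  define v where "v = u(m := (\<lambda>x. inverse (sqrt q) * w x))"
  have v_c: "\<exists>c. v i = (\<lambda>x. \<Sum>j<Suc m. c j * e j x)" if "i < Suc m" for i
  proof (cases "i = m")
    case True
    then show ?thesis unfolding v_def
      by (intro exI[of _ "\<lambda>j. inverse (sqrt q) * c j"])
        (auto simp del: sum.lessThan_Suc simp: w_c sum_distrib_left mult.assoc)
  next
    case False
    then have "i < m" using that by simp
    then show ?thesis
      by (intro exI[of _ "(C i)(m := 0)"]) (simp add: v_def C)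
  qed
  have vv: "(\<integral>x. v i x * v j x \<partial>M) = of_bool (i = j)" if "i < Suc m" "j < Suc m" for i j
  proof -
    have *: "(\<integral>x. u i x * w x \<partial>M) = 0" if "i < m" for i
      using wu[OF that] by (simp add: mult.commute)
    have "(\<integral>x. inverse (sqrt q) * w x * (inverse (sqrt q) * w x) \<partial>M) = 1"
    proof -
      have "(\<integral>x. inverse (sqrt q) * w x * (inverse (sqrt q) * w x) \<partial>M) =
          (\<integral>x. inverse (sqrt q) * inverse (sqrt q) * (w x * w x) \<partial>M)"
        by (simp add: ac_simps)
      also have "\<dots> = inverse (sqrt q) * inverse (sqrt q) * q"
        unfolding q_def by (rule integral_mult_right_zero)
      also have "\<dots> = 1"
        using q by (simp add: field_simps)
      finally show ?thesis .
    qed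
    moreover have "(\<integral>x. inverse (sqrt q) * w x * u j x \<partial>M) = 0" if "j < m" for j
      using wu[OF that] by (simp add: mult.assoc)
    moreover have "(\<integral>x. u j x * (inverse (sqrt q) * w x) \<partial>M) = 0" if "j < m" for j
      using *[OF that] by (simp add: mult.left_commute)
    ultimately show ?thesis
      using that on by (auto simp: v_def less_Suc_eq)
  qed
  show ?case
    by (rule exI[of _ v]) (use v_c vv in blast)
qed simp

section \<open>Integral operators whose Gram kernel is square integrable\<close>

text \<open>Square integrability is imposed on the Gram kernel and not on \<open>k\<close>: the
  square of the singular kernel is |G x - h t|^(-d), which is not integrable around the interior
  point \<open>matrix_inv G *v h t\<close> of \<open>D\<close>. The condition is stated with
  \<open>ennreal\<close> integrals, so that it is meaningful before any integrability is
  known.\<close>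

locale square_integrable_gram =
  M: sigma_finite_measure M + N: sigma_finite_measure N
  for M :: "'a measure" and N :: "'b measure" +
  fixes k :: "'a \<Rightarrow> 'b \<Rightarrow> real"
  assumes k_measurable [measurable]: "case_prod k \<in> borel_measurable (M \<Otimes>\<^sub>M N)"
    and k_nonneg: "0 \<le> k x t"
    and gram_finite: "(\<integral>\<^sup>+x. \<integral>\<^sup>+y. (\<integral>\<^sup>+t. ennreal (k x t * k y t) \<partial>N)\<^sup>2 \<partial>M \<partial>M) < \<infinity>"
begin

sublocale MN: pair_sigma_finite M N ..
sublocale NM: pair_sigma_finite N M ..
sublocale MM: pair_sigma_finite M M ..

definition nn_gram :: "'a \<Rightarrow> 'a \<Rightarrow> ennreal" where
  "nn_gram x y = (\<integral>\<^sup>+t. ennreal (k x t * k y t) \<partial>N)"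

definition gram :: "'a \<Rightarrow> 'a \<Rightarrow> real" where
  "gram x y = (\<integral>t. k x t * k y t \<partial>N)"

lemma gram_commute: "gram x y = gram y x"
  by (simp add: gram_def mult.commute)

lemma nn_gram_measurable [measurable]: "case_prod nn_gram \<in> borel_measurable (M \<Otimes>\<^sub>M M)"
  unfolding nn_gram_def by measurable

lemma gram_measurable [measurable]: "case_prod gram \<in> borel_measurable (M \<Otimes>\<^sub>M M)"
  unfolding gram_def by measurable

text \<open>Where the defining integral diverges, \<open>nn_gram\<close> is infinite while
  \<open>gram\<close> takes the default value 0 of the Bochner integral, so in general there is only
  an inequality.\<close>

lemma gram_le_nn_gram:
  assumes "x \<in> space M" "y \<in> space M"
  shows "ennreal (gram x y) \<le> nn_gram x y"
proof -
  have [measurable]: "(\<lambda>t. k x t * k y t) \<in> borel_measurable N"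
    using assms by measurable
  have "gram x y = enn2real (nn_gram x y)"
    unfolding gram_def nn_gram_def by (rule integral_eq_nn_integral) (auto simp: k_nonneg)
  then show ?thesis
    by (cases "nn_gram x y") auto
qed

lemma gram_nonneg: "0 \<le> gram x y"
  unfolding gram_def by (intro Bochner_Integration.integral_nonneg) (simp add: k_nonneg)

text \<open>The squared Hilbert-Schmidt norm of the operator with kernel \<open>gram\<close>. By
  \<open>gram_finite\<close> the integral is finite, so \<open>enn2real\<close> loses
  nothing.\<close>

definition hs_norm_sq :: real where
  "hs_norm_sq = enn2real (\<integral>\<^sup>+x. \<integral>\<^sup>+y. (nn_gram x y)\<^sup>2 \<partial>M \<partial>M)"

lemma nn_integral_gram_sq: "(\<integral>\<^sup>+x. \<integral>\<^sup>+y. ennreal ((gram x y)\<^sup>2) \<partial>M \<partial>M) \<le> ennreal hs_norm_sq"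
proof -
  have "ennreal hs_norm_sq = (\<integral>\<^sup>+x. \<integral>\<^sup>+y. (nn_gram x y)\<^sup>2 \<partial>M \<partial>M)"
    unfolding hs_norm_sq_def using gram_finite by (simp add: nn_gram_def)
  moreover have "(\<integral>\<^sup>+x. \<integral>\<^sup>+y. ennreal ((gram x y)\<^sup>2) \<partial>M \<partial>M) \<le> (\<integral>\<^sup>+x. \<integral>\<^sup>+y. (nn_gram x y)\<^sup>2 \<partial>M \<partial>M)"
    by (intro nn_integral_mono)
      (auto simp: ennreal_power[symmetric] gram_nonneg intro!: power_mono gram_le_nn_gram)
  ultimately show ?thesis by simp
qed

lemma integrable_gram_sq: "integrable (M \<Otimes>\<^sub>M M) (\<lambda>(x, y). (gram x y)\<^sup>2)"
proof (rule integrableI_bounded)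
  have "(\<integral>\<^sup>+z. ennreal (norm (case z of (x, y) \<Rightarrow> (gram x y)\<^sup>2)) \<partial>(M \<Otimes>\<^sub>M M)) =
      (\<integral>\<^sup>+x. \<integral>\<^sup>+y. ennreal ((gram x y)\<^sup>2) \<partial>M \<partial>M)"
    by (subst M.nn_integral_fst[symmetric]) auto
  also have "\<dots> < \<infinity>"
    using nn_integral_gram_sq by (rule order.strict_trans1) simp
  finally show "(\<integral>\<^sup>+z. ennreal (norm (case z of (x, y) \<Rightarrow> (gram x y)\<^sup>2)) \<partial>(M \<Otimes>\<^sub>M M)) < \<infinity>" .
qed simp

text \<open>By Fubini almost every row of a square integrable kernel is square integrable. This
  makes Bessel's inequality applicable to \<open>gram x\<close>.\<close>

lemma AE_gram_L2: "AE x in M. gram x \<in> L2_space M"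
proof -
  have "AE x in M. integrable M (\<lambda>y. (gram x y)\<^sup>2)"
    using MM.AE_integrable_fst'[OF integrable_gram_sq] by simp
  then show ?thesis
  proof (rule AE_mp, intro AE_I2 impI)
    fix x assume "x \<in> space M" "integrable M (\<lambda>y. (gram x y)\<^sup>2)"
    moreover from this(1) have "gram x \<in> borel_measurable M" by measurable
    ultimately show "gram x \<in> L2_space M" by (simp add: L2_space_def)
  qed
qed

section \<open>The integral operator with the Gram kernel\<close>

definition gram_op :: "('a \<Rightarrow> real) \<Rightarrow> 'a \<Rightarrow> real" where
  "gram_op v x = (\<integral>y. gram x y * v y \<partial>M)"

text \<open>Fubini in \<open>y\<close> and \<open>t\<close>, for every \<open>x\<close> whose row
  \<open>nn_gram x\<close> is square integrable, hence for almost every \<open>x\<close>. Absolute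
  integrability of \<open>k x t * k y t * v y\<close> follows by pairing \<open>nn_gram x\<close>
  with \<open>\<bar>v\<bar>\<close>, both having integrable squares.\<close>

lemma normal_eq_gram_op:
  assumes v: "v \<in> L2_space M"
  shows "AE x in M. integral_op N (\<lambda>t x. k x t) (integral_op M k v) x = gram_op v x"
proof -
  have [measurable]: "v \<in> borel_measurable M" and v2: "integrable M (\<lambda>x. (v x)\<^sup>2)"
    using v by (auto simp: L2_space_def)
  have "AE x in M. (\<integral>\<^sup>+y. (nn_gram x y)\<^sup>2 \<partial>M) \<noteq> \<infinity>"
    by (rule nn_integral_PInf_AE) (use gram_finite in \<open>auto simp: nn_gram_def\<close>)
  then show ?thesis
  proof (rule AE_mp, intro AE_I2 impI)
    fix x assume x [measurable]: "x \<in> space M" and fin: "(\<integral>\<^sup>+y. (nn_gram x y)\<^sup>2 \<partial>M) \<noteq> \<infinity>"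
    have int: "integrable (M \<Otimes>\<^sub>M N) (\<lambda>(y, t). k x t * k y t * v y)"
    proof (rule integrableI_bounded)
      \<comment> \<open>The product is at most the square of its larger factor; arguing this way
        avoids subtraction in \<open>ennreal\<close>.\<close>
      have am_gm: "a * b \<le> a\<^sup>2 + b\<^sup>2" for a b :: ennreal
      proof (cases "a \<le> b")
        case True
        then have "a * b \<le> b * b" by (rule mult_right_mono) simp
        also have "\<dots> \<le> a\<^sup>2 + b\<^sup>2" by (simp add: power2_eq_square add_increasing)
        finally show ?thesis .
      next
        case False
        then have "a * b \<le> a * a" by (intro mult_left_mono) auto
        also have "\<dots> \<le> a\<^sup>2 + b\<^sup>2" by (simp add: power2_eq_square add_increasing2)
        finally show ?thesis .
      qed
      have "(\<integral>\<^sup>+z. ennreal (norm (case z of (y, t) \<Rightarrow> k x t * k y t * v y)) \<partial>(M \<Otimes>\<^sub>M N)) =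
          (\<integral>\<^sup>+y. \<integral>\<^sup>+t. ennreal (norm (k x t * k y t * v y)) \<partial>N \<partial>M)"
        by (subst N.nn_integral_fst[symmetric]) auto
      also have "\<dots> = (\<integral>\<^sup>+y. nn_gram x y * ennreal \<bar>v y\<bar> \<partial>M)"
        unfolding nn_gram_def
        by (intro nn_integral_cong)
          (auto simp: abs_mult k_nonneg ennreal_mult' nn_integral_multc[symmetric])
      also have "\<dots> \<le> (\<integral>\<^sup>+y. (nn_gram x y)\<^sup>2 + ennreal ((v y)\<^sup>2) \<partial>M)"
        using am_gm[of "nn_gram x _" "ennreal \<bar>v _\<bar>"]
        by (intro nn_integral_mono) (simp add: ennreal_power)
      also have "\<dots> = (\<integral>\<^sup>+y. (nn_gram x y)\<^sup>2 \<partial>M) + (\<integral>\<^sup>+y. ennreal ((v y)\<^sup>2) \<partial>M)"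
        by (intro nn_integral_add) auto
      also have "\<dots> < \<infinity>"
        using fin v2 by (auto simp: nn_integral_eq_integral less_top)
      finally show "(\<integral>\<^sup>+z. ennreal (norm (case z of (y, t) \<Rightarrow> k x t * k y t * v y)) \<partial>(M \<Otimes>\<^sub>M N)) < \<infinity>" .
    qed measurable
    have "integral_op N (\<lambda>t x. k x t) (integral_op M k v) x = (\<integral>t. \<integral>y. k x t * k y t * v y \<partial>M \<partial>N)"
      by (simp add: integral_op_def mult.assoc)
    also have "\<dots> = (\<integral>y. \<integral>t. k x t * k y t * v y \<partial>N \<partial>M)"
      by (rule MN.Fubini_integral[OF int])
    also have "\<dots> = gram_op v x"
      by (simp add: gram_op_def gram_def)
    finally show "integral_op N (\<lambda>t x. k x t) (integral_op M k v) x = gram_op v x" .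
  qed
qed

text \<open>Fubini together with the symmetry of \<open>gram\<close>. Pairing
  \<open>gram x y\<close> with \<open>w x * v y\<close> dominates the integrand by the sum of their
  squares, and both squares are integrable on the product.\<close>

lemma gram_op_symmetric:
  assumes "v \<in> L2_space M" "w \<in> L2_space M"
  shows "(\<integral>x. gram_op v x * w x \<partial>M) = (\<integral>x. v x * gram_op w x \<partial>M)"
proof -
  have [measurable]: "v \<in> borel_measurable M" "w \<in> borel_measurable M"
    and i: "integrable M (\<lambda>x. (v x)\<^sup>2)" "integrable M (\<lambda>x. (w x)\<^sup>2)"
    using assms by (auto simp: L2_space_def)
  have wv: "integrable (M \<Otimes>\<^sub>M M) (\<lambda>(x, y). (w x)\<^sup>2 * (v y)\<^sup>2)"
    by (rule MM.Fubini_integrable) (use i in auto)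
  have int: "integrable (M \<Otimes>\<^sub>M M) (\<lambda>(x, y). gram x y * v y * w x)"
  proof (rule Bochner_Integration.integrable_bound)
    show "integrable (M \<Otimes>\<^sub>M M) (\<lambda>z. (case z of (x, y) \<Rightarrow> (gram x y)\<^sup>2) + (case z of (x, y) \<Rightarrow> (w x)\<^sup>2 * (v y)\<^sup>2))"
      using wv integrable_gram_sq by simp
    have "\<bar>gram x y * v y * w x\<bar> \<le> (gram x y)\<^sup>2 + (w x)\<^sup>2 * (v y)\<^sup>2" for x y
      using abs_mult_le_sum_sq[of "gram x y" "w x * v y"]
      by (simp add: power_mult_distrib mult_ac)
    then show "AE z in M \<Otimes>\<^sub>M M. norm (case z of (x, y) \<Rightarrow> gram x y * v y * w x) \<le>
        norm ((case z of (x, y) \<Rightarrow> (gram x y)\<^sup>2) + (case z of (x, y) \<Rightarrow> (w x)\<^sup>2 * (v y)\<^sup>2))"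
      by (auto simp: split_beta)
  qed measurable
  have "(\<integral>x. gram_op v x * w x \<partial>M) = (\<integral>x. \<integral>y. gram x y * v y * w x \<partial>M \<partial>M)"
    by (simp add: gram_op_def)
  also have "\<dots> = (\<integral>y. \<integral>x. gram x y * v y * w x \<partial>M \<partial>M)"
    by (rule MM.Fubini_integral[OF int, symmetric])
  also have "\<dots> = (\<integral>y. \<integral>x. v y * (gram y x * w x) \<partial>M \<partial>M)"
    by (simp add: gram_commute[of _ "_ :: 'a"] mult_ac)
  also have "\<dots> = (\<integral>x. v x * gram_op w x \<partial>M)"
    by (simp add: gram_op_def)
  finally show ?thesis .
qed

section \<open>Bounds for the eigenvalues by the Hilbert-Schmidt norm\<close>

text \<open>The coefficient of the row \<open>gram x\<close> along \<open>u p\<close> is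
  \<open>gram_op (u p) x\<close>, that is \<open>\<mu> p * u p x\<close>. Bessel's inequality at
  almost every \<open>x\<close>, integrated over \<open>x\<close>, yields the claim because each
  \<open>u p\<close> is normalized.\<close>

theorem sum_eigenvalue_sq_le:
  assumes P: "finite P" and u: "\<And>p. p \<in> P \<Longrightarrow> u p \<in> L2_space M"
    and on: "\<And>p q. p \<in> P \<Longrightarrow> q \<in> P \<Longrightarrow> (\<integral>x. u p x * u q x \<partial>M) = of_bool (p = q)"
    and eig: "\<And>p. p \<in> P \<Longrightarrow> AE x in M. gram_op (u p) x = \<mu> p * u p x"
  shows "(\<Sum>p\<in>P. (\<mu> p)\<^sup>2) \<le> hs_norm_sq"
proof -
  have [measurable]: "u p \<in> borel_measurable M" if "p \<in> P" for p
    using u[OF that] by (simp add: L2_space_def)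
  have uu: "integrable M (\<lambda>x. (\<mu> p * u p x)\<^sup>2)" "(\<integral>x. (\<mu> p * u p x)\<^sup>2 \<partial>M) = (\<mu> p)\<^sup>2" if "p \<in> P" for p
    using L2_space_mult_integrable[OF u u, OF that that] on[OF that that]
    by (auto simp: power_mult_distrib power2_eq_square[of "u p _"])
  have "ennreal (\<Sum>p\<in>P. (\<mu> p)\<^sup>2) = (\<Sum>p\<in>P. ennreal (\<integral>x. (\<mu> p * u p x)\<^sup>2 \<partial>M))"
    using uu by simp
  also have "\<dots> = (\<Sum>p\<in>P. \<integral>\<^sup>+x. ennreal ((\<mu> p * u p x)\<^sup>2) \<partial>M)"
    using uu by (intro sum.cong refl nn_integral_eq_integral[symmetric]) auto
  also have "\<dots> = (\<integral>\<^sup>+x. (\<Sum>p\<in>P. ennreal ((\<mu> p * u p x)\<^sup>2)) \<partial>M)"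
    by (intro nn_integral_sum[symmetric]) auto
  also have "\<dots> \<le> (\<integral>\<^sup>+x. \<integral>\<^sup>+y. ennreal ((gram x y)\<^sup>2) \<partial>M \<partial>M)"
  proof (rule nn_integral_mono_AE)
    have "AE x in M. \<forall>p\<in>P. gram_op (u p) x = \<mu> p * u p x"
      using eig P by (simp add: AE_finite_all)
    with AE_gram_L2
    show "AE x in M. (\<Sum>p\<in>P. ennreal ((\<mu> p * u p x)\<^sup>2)) \<le> (\<integral>\<^sup>+y. ennreal ((gram x y)\<^sup>2) \<partial>M)"
    proof eventually_elim
      case (elim x)
      have "(\<Sum>p\<in>P. ennreal ((\<mu> p * u p x)\<^sup>2)) = ennreal (\<Sum>p\<in>P. (\<integral>y. gram x y * u p y \<partial>M)\<^sup>2)"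
        using elim(2) by (simp add: gram_op_def)
      also have "\<dots> \<le> ennreal (\<integral>y. (gram x y)\<^sup>2 \<partial>M)"
        by (intro ennreal_leI bessel_inequality P u on elim)
      also have "\<dots> = (\<integral>\<^sup>+y. ennreal ((gram x y)\<^sup>2) \<partial>M)"
        using elim(1) by (intro nn_integral_eq_integral[symmetric]) (auto simp: L2_space_def)
      finally show ?case .
    qed
  qed
  also have "\<dots> \<le> ennreal hs_norm_sq" by (rule nn_integral_gram_sq)
  finally show ?thesis
    by (subst (asm) ennreal_le_iff) (simp_all add: hs_norm_sq_def)
qed

text \<open>The distinct values among \<open>lam 1\<close>, ..., \<open>lam n\<close> have total
  multiplicity at least \<open>n\<close>, and all of them are at least \<open>lam n\<close>.
  Orthonormal bases of their eigenspaces together form one orthonormal system, to which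
  \<open>sum_eigenvalue_sq_le\<close> applies.\<close>

theorem eigenvalue_sequence_bound:
  assumes eigs: "eigenvalue_sequence M (integral_op N (\<lambda>t x. k x t) \<circ> integral_op M k) lam" and n: "1 \<le> n"
  shows "real n * (lam n)\<^sup>2 \<le> hs_norm_sq"
\<comment> \<open>The value 0 is split off because \<open>eigenvalue_sequence\<close> describes
  eigenspaces only for positive values.\<close>
proof (cases "lam n = 0")
  case True
  then show ?thesis by (simp add: hs_norm_sq_def)
next
  case False
  define A where "A = integral_op N (\<lambda>t x. k x t) \<circ> integral_op M k"
  define mult where "mult \<mu> = card {j. 1 \<le> j \<and> lam j = \<mu>}" for \<mu>
  have lam_pos: "0 < lam n" and lam_mono: "\<And>j. 1 \<le> j \<Longrightarrow> j \<le> n \<Longrightarrow> lam n \<le> lam j"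
    using eigs n False by (auto simp: eigenvalue_sequence_def order.strict_iff_order)
  have fin: "finite {j. 1 \<le> j \<and> lam j = \<mu>}"
    and dim: "AE_dimension M (L2_eigenspace M A \<mu>) (mult \<mu>)" if "\<mu> > 0" for \<mu>
    using eigs that by (auto simp: eigenvalue_sequence_def A_def mult_def)
  have A_gram: "AE x in M. A v x = gram_op v x" if "v \<in> L2_space M" for v
    using normal_eq_gram_op[OF that] by (simp add: A_def)
  have "\<exists>u. \<forall>i<mult \<mu>. u i \<in> L2_space M \<and> (AE x in M. gram_op (u i) x = \<mu> * u i x) \<and>
      (\<forall>j<mult \<mu>. (\<integral>x. u i x * u j x \<partial>M) = of_bool (i = j))" if \<mu>: "\<mu> > 0" for \<mu>
  proof -
    obtain e where e: "\<And>i. i < mult \<mu> \<Longrightarrow> e i \<in> L2_eigenspace M A \<mu>"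
      and indep: "\<And>c :: nat \<Rightarrow> real. (AE x in M. (\<Sum>i<mult \<mu>. c i * e i x) = 0) \<Longrightarrow> \<forall>i<mult \<mu>. c i = 0"
      using dim[OF \<mu>] unfolding AE_dimension_def by blast
    have e_L2: "e i \<in> L2_space M" if "i < mult \<mu>" for i
      using e[OF that] by (simp add: L2_eigenspace_def)
    have "AE x in M. gram_op (e i) x = \<mu> * e i x" if "i < mult \<mu>" for i
      using A_gram[OF e_L2[OF that]] e[OF that] by (auto simp: L2_eigenspace_def)
    then have e_eig: "AE x in M. \<forall>i\<in>{..<mult \<mu>}. gram_op (e i) x = \<mu> * e i x"
      by (subst AE_finite_all) auto
    obtain u where u: "\<And>i. i < mult \<mu> \<Longrightarrow> \<exists>c. u i = (\<lambda>x. \<Sum>j<mult \<mu>. c j * e j x)"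
      and on: "\<And>i j. i < mult \<mu> \<Longrightarrow> j < mult \<mu> \<Longrightarrow> (\<integral>x. u i x * u j x \<partial>M) = of_bool (i = j)"
      using gram_schmidt[where e = e and M = M and m = "mult \<mu>", OF e_L2 indep] by force
    have "u i \<in> L2_space M \<and> (AE x in M. gram_op (u i) x = \<mu> * u i x)" if i: "i < mult \<mu>" for i
    proof
      obtain c where c: "u i = (\<lambda>x. \<Sum>j<mult \<mu>. c j * e j x)" using u[OF i] by blast
      show "u i \<in> L2_space M" unfolding c using e_L2 by (intro L2_space_sum) auto
      \<comment> \<open>The operator may be applied termwise only at points \<open>x\<close> with
        \<open>gram x\<close> in L2, where each product \<open>gram x y * e j y\<close> is
        integrable in \<open>y\<close>.\<close>
      show "AE x in M. gram_op (u i) x = \<mu> * u i x"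
        using AE_gram_L2 e_eig
      proof eventually_elim
        case (elim x)
        have "gram_op (u i) x = (\<Sum>j<mult \<mu>. c j * gram_op (e j) x)"
          unfolding gram_op_def c
          using integral_sum_mult[of "{..<mult \<mu>}" e M "gram x" c] e_L2 elim(1) by (simp add: mult.commute)
        also have "\<dots> = (\<Sum>j<mult \<mu>. \<mu> * (c j * e j x))"
          using elim(2) by (simp add: mult_ac)
        finally show ?case by (simp add: c sum_distrib_left)
      qed
    qed
    then show ?thesis using on by blast
  qed
  then obtain U where "\<And>\<mu> i. \<mu> > 0 \<Longrightarrow> i < mult \<mu> \<Longrightarrow>
      U \<mu> i \<in> L2_space M \<and> (AE x in M. gram_op (U \<mu> i) x = \<mu> * U \<mu> i x) \<and>
      (\<forall>j<mult \<mu>. (\<integral>x. U \<mu> i x * U \<mu> j x \<partial>M) = of_bool (i = j))"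
    by metis
  then have U: "\<And>\<mu> i. \<mu> > 0 \<Longrightarrow> i < mult \<mu> \<Longrightarrow> U \<mu> i \<in> L2_space M"
    and eig: "\<And>\<mu> i. \<mu> > 0 \<Longrightarrow> i < mult \<mu> \<Longrightarrow> AE x in M. gram_op (U \<mu> i) x = \<mu> * U \<mu> i x"
    and on: "\<And>\<mu> i j. \<mu> > 0 \<Longrightarrow> i < mult \<mu> \<Longrightarrow> j < mult \<mu> \<Longrightarrow>
      (\<integral>x. U \<mu> i x * U \<mu> j x \<partial>M) = of_bool (i = j)"
    by blast+
  \<comment> \<open>Symmetry of the operator gives \<mu> \<integral> u v = \<nu> \<integral> u v for
    eigenfunctions \<open>u\<close> and \<open>v\<close> to the eigenvalues \<mu> and \<nu>.\<close>
  have orth: "(\<integral>x. U \<mu> i x * U \<nu> j x \<partial>M) = 0"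
    if "\<mu> > 0" "\<nu> > 0" "\<mu> \<noteq> \<nu>" "i < mult \<mu>" "j < mult \<nu>" for \<mu> \<nu> i j
  proof -
    have [measurable]: "U \<mu> i \<in> borel_measurable M" "U \<nu> j \<in> borel_measurable M"
      using U[OF that(1,4)] U[OF that(2,5)] by (auto simp: L2_space_def)
    have [measurable]: "gram_op v \<in> borel_measurable M" if [measurable]: "v \<in> borel_measurable M" for v
      unfolding gram_op_def[abs_def] by measurable
    have "\<mu> * (\<integral>x. U \<mu> i x * U \<nu> j x \<partial>M) = (\<integral>x. \<mu> * U \<mu> i x * U \<nu> j x \<partial>M)"
      by (simp add: mult.assoc)
    also have "\<dots> = (\<integral>x. gram_op (U \<mu> i) x * U \<nu> j x \<partial>M)"
      using eig[OF that(1,4)] by (intro integral_cong_AE) auto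
    also have "\<dots> = (\<integral>x. U \<mu> i x * gram_op (U \<nu> j) x \<partial>M)"
      by (intro gram_op_symmetric U that)
    also have "\<dots> = (\<integral>x. \<nu> * (U \<mu> i x * U \<nu> j x) \<partial>M)"
      using eig[OF that(2,5)] by (intro integral_cong_AE) (auto simp: mult_ac)
    finally show ?thesis using \<open>\<mu> \<noteq> \<nu>\<close> by simp
  qed
  define L where "L = lam ` {1..n}"
  have L_pos: "\<mu> > 0" "lam n \<le> \<mu>" if "\<mu> \<in> L" for \<mu>
    using that lam_mono lam_pos unfolding L_def by force+
  \<comment> \<open>One index per basis function of each eigenspace. \<open>P\<close> can have more
    than \<open>n\<close> elements, when the value \<open>lam n\<close> recurs after position
    \<open>n\<close>.\<close>
  define P where "P = (SIGMA \<mu>:L. {..<mult \<mu>})"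
  have "(\<Sum>p\<in>P. (fst p)\<^sup>2) \<le> hs_norm_sq"
  proof (rule sum_eigenvalue_sq_le[where u = "\<lambda>p. U (fst p) (snd p)"])
    show "finite P" by (simp add: P_def L_def)
    fix p assume p: "p \<in> P"
    then show "U (fst p) (snd p) \<in> L2_space M"
      "AE x in M. gram_op (U (fst p) (snd p)) x = fst p * U (fst p) (snd p) x"
      using U eig L_pos(1) by (auto simp: P_def)
    fix q assume q: "q \<in> P"
    show "(\<integral>x. U (fst p) (snd p) x * U (fst q) (snd q) x \<partial>M) = of_bool (p = q)"
      using p q on orth L_pos(1) by (cases "fst p = fst q") (auto simp: P_def prod_eq_iff)
  qed
  moreover have "real n * (lam n)\<^sup>2 \<le> (\<Sum>p\<in>P. (fst p)\<^sup>2)"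
  proof -
    have "n = card {1..n}" by simp
    also have "\<dots> \<le> card (\<Union>\<mu>\<in>L. {j. 1 \<le> j \<and> lam j = \<mu>})"
      using fin L_pos(1) by (intro card_mono) (auto simp: L_def)
    also have "\<dots> = (\<Sum>\<mu>\<in>L. mult \<mu>)"
      unfolding mult_def using fin L_pos(1) by (intro card_UN_disjoint) (auto simp: L_def)
    also have "\<dots> = card P"
      unfolding P_def by (subst card_SigmaI) (auto simp: L_def)
    finally have "n \<le> card P" .
    then have "real n * (lam n)\<^sup>2 \<le> real (card P) * (lam n)\<^sup>2"
      by (intro mult_right_mono) auto
    also have "\<dots> = (\<Sum>p\<in>P. (lam n)\<^sup>2)" by simp
    also have "\<dots> \<le> (\<Sum>p\<in>P. (fst p)\<^sup>2)"
      using L_pos(2) lam_pos by (intro sum_mono power_mono) (auto simp: P_def)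
    finally show ?thesis .
  qed
  ultimately show ?thesis by linarith
qed

end

section \<open>Exchanging the two Gram kernels of an integral operator\<close>

text \<open>An operator composed with its adjoint has the same Hilbert-Schmidt norm in either order.
  With each square written as a double integral, both sides become integrals of the same function
  \<open>F\<close> of four variables, and Tonelli applies because all values lie in
  \<open>ennreal\<close>.\<close>

lemma (in pair_sigma_finite) nn_integral_gram_swap:
  fixes K :: "'a \<Rightarrow> 'b \<Rightarrow> ennreal"
  assumes [measurable]: "case_prod K \<in> borel_measurable (M1 \<Otimes>\<^sub>M M2)"
  shows "(\<integral>\<^sup>+x. \<integral>\<^sup>+y. (\<integral>\<^sup>+t. K x t * K y t \<partial>M2)\<^sup>2 \<partial>M1 \<partial>M1) =
         (\<integral>\<^sup>+t. \<integral>\<^sup>+s. (\<integral>\<^sup>+x. K x t * K x s \<partial>M1)\<^sup>2 \<partial>M2 \<partial>M2)"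
proof -
  define F where "F x y t s = K x t * K y t * (K x s * K y s)" for x y t s
  have sq: "(\<integral>\<^sup>+t. \<integral>\<^sup>+s. g t * g s \<partial>M \<partial>M) = (\<integral>\<^sup>+t. g t \<partial>M)\<^sup>2"
    if "g \<in> borel_measurable M" for g :: "'c \<Rightarrow> ennreal" and M
    using that by (simp add: nn_integral_cmult nn_integral_multc power2_eq_square)
  have "(\<integral>\<^sup>+x. \<integral>\<^sup>+y. (\<integral>\<^sup>+t. K x t * K y t \<partial>M2)\<^sup>2 \<partial>M1 \<partial>M1) =
      (\<integral>\<^sup>+x. \<integral>\<^sup>+y. \<integral>\<^sup>+t. \<integral>\<^sup>+s. F x y t s \<partial>M2 \<partial>M2 \<partial>M1 \<partial>M1)"
    unfolding F_def by (intro nn_integral_cong sq[symmetric]) measurable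
  \<comment> \<open>Four exchanges of neighbouring integrals take the order x, y, t, s to t, s, x,
    y.\<close>
  also have "\<dots> = (\<integral>\<^sup>+x. \<integral>\<^sup>+t. \<integral>\<^sup>+y. \<integral>\<^sup>+s. F x y t s \<partial>M2 \<partial>M1 \<partial>M2 \<partial>M1)"
    unfolding F_def by (intro nn_integral_cong Fubini'[symmetric]) measurable
  also have "\<dots> = (\<integral>\<^sup>+x. \<integral>\<^sup>+t. \<integral>\<^sup>+s. \<integral>\<^sup>+y. F x y t s \<partial>M1 \<partial>M2 \<partial>M2 \<partial>M1)"
    unfolding F_def by (intro nn_integral_cong Fubini'[symmetric]) measurable
  also have "\<dots> = (\<integral>\<^sup>+t. \<integral>\<^sup>+x. \<integral>\<^sup>+s. \<integral>\<^sup>+y. F x y t s \<partial>M1 \<partial>M2 \<partial>M1 \<partial>M2)"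
    unfolding F_def by (intro Fubini'[symmetric]) measurable
  also have "\<dots> = (\<integral>\<^sup>+t. \<integral>\<^sup>+s. \<integral>\<^sup>+x. \<integral>\<^sup>+y. F x y t s \<partial>M1 \<partial>M1 \<partial>M2 \<partial>M2)"
    unfolding F_def by (intro nn_integral_cong Fubini'[symmetric]) measurable
  also have "\<dots> = (\<integral>\<^sup>+t. \<integral>\<^sup>+s. (\<integral>\<^sup>+x. K x t * K x s \<partial>M1)\<^sup>2 \<partial>M2 \<partial>M2)"
  proof (intro nn_integral_cong)
    fix t s assume [measurable]: "t \<in> space M2" "s \<in> space M2"
    have "(\<lambda>x. K x t * K x s) \<in> borel_measurable M1" by measurable
    from sq[OF this]
    show "(\<integral>\<^sup>+x. \<integral>\<^sup>+y. F x y t s \<partial>M1 \<partial>M1) = (\<integral>\<^sup>+x. K x t * K x s \<partial>M1)\<^sup>2"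
      by (simp add: F_def mult_ac)
  qed
  finally show ?thesis .
qed

section \<open>Negative powers with value infinity at zero\<close>

text \<open>This is \<open>u powr - a\<close> except at 0, where \<open>powr\<close> would give 0.
  The value infinity makes the function antitone on the whole half-line, so upper bounds hold
  without exceptional points.\<close>

definition inv_powr :: "real \<Rightarrow> real \<Rightarrow> ennreal" where
  "inv_powr a u = inverse (ennreal (u powr a))"

lemma inv_powr_measurable [measurable]: "inv_powr a \<in> borel_measurable borel"
  unfolding inv_powr_def[abs_def] by measurable

lemma inv_powr_0 [simp]: "inv_powr a 0 = top"
  by (simp add: inv_powr_def)

lemma inv_powr_pos: "u > 0 \<Longrightarrow> inv_powr a u = ennreal (u powr - a)"
  by (simp add: inv_powr_def inverse_ennreal powr_minus)

lemma inv_powr_antimono: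
  assumes "0 \<le> u" "u \<le> v" "0 \<le> a"
  shows "inv_powr a v \<le> inv_powr a u"
proof (cases "u = 0")
  case False
  then show ?thesis
    using assms by (simp add: inv_powr_pos powr_mono2' ennreal_leI)
qed simp

lemma inv_powr_power: "0 \<le> u \<Longrightarrow> 0 < n \<Longrightarrow> inv_powr a u ^ n = inv_powr (real n * a) u"
  by (cases "u = 0")
    (simp_all add: inv_powr_pos ennreal_power ennreal_top_eq_mult_iff powr_powr mult.commute flip: powr_realpow)

lemma inv_powr_mult: "0 < c \<Longrightarrow> 0 \<le> u \<Longrightarrow> inv_powr a (c * u) = inv_powr a c * inv_powr a u"
  by (cases "u = 0") (simp_all add: inv_powr_pos powr_mult ennreal_mult' ennreal_mult_top)

text \<open>Split v^(-p) into v^(-(p-d)) v^(-d). Since \<open>u \<le> v\<close>, the first factor is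
  at most u^(-(p-d)); since \<open>b \<le> v\<close>, the second is at most b^(-d). At
  \<open>u = 0\<close> the left side is 0 by the convention for \<open>powr\<close>.\<close>

lemma product_bound_ordered:
  assumes "0 \<le> u" "u \<le> v" "0 \<le> b" "b \<le> v" "0 \<le> d" "d \<le> p"
  shows "ennreal (u powr - p * v powr - p) \<le> inv_powr d b * inv_powr (2 * p - d) u"
proof (cases "u = 0")
  case False
  then have pos: "0 < u" "0 < v" using assms by auto
  have "u powr - p * v powr - p = u powr - p * (v powr - (p - d) * v powr - d)"
    by (simp flip: powr_add)
  also have "\<dots> \<le> u powr - p * (u powr - (p - d) * v powr - d)"
    using assms pos by (intro mult_left_mono mult_right_mono powr_mono2') auto
  also have "\<dots> = v powr - d * u powr - (2 * p - d)"
    by (simp add: algebra_simps flip: powr_add)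
  finally have "ennreal (u powr - p * v powr - p) \<le> inv_powr d v * inv_powr (2 * p - d) u"
    using pos by (simp add: inv_powr_pos ennreal_leI flip: ennreal_mult')
  also have "\<dots> \<le> inv_powr d b * inv_powr (2 * p - d) u"
    using assms by (intro mult_right_mono inv_powr_antimono) auto
  finally show ?thesis .
qed simp

text \<open>The larger of \<open>u\<close> and \<open>v\<close> is at least \<open>b / 2\<close>.
  Adding the powers of both makes the bound independent of which one is smaller.\<close>

lemma product_bound:
  assumes "0 \<le> u" "0 \<le> v" "0 \<le> b" "b \<le> u + v" "0 \<le> d" "d \<le> p"
  shows "ennreal (u powr - p * v powr - p) \<le>
    inv_powr d (b / 2) * (inv_powr (2 * p - d) u + inv_powr (2 * p - d) v)"
proof (cases "u \<le> v")
  case True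
  then show ?thesis
    using product_bound_ordered[of u v "b / 2" d p] assms
    by (auto simp: distrib_left intro: order_trans)
next
  case False
  then show ?thesis
    using product_bound_ordered[of v u "b / 2" d p] assms
    by (auto simp: distrib_left mult.commute[of "u powr _"] intro: order_trans)
qed

section \<open>Uniform integrals of negative powers on bounded sets\<close>

text \<open>Moving the singularity to 0 sends the interval into [-2R, 2R] for every admissible
  \<open>z\<close>; each half of that interval contributes the same finite integral
  \<open>I\<close>.\<close>

lemma inv_powr_integral_bound_real:
  assumes a: "0 < a" "a < 1" and R: "0 \<le> R"
  shows "\<exists>C<\<infinity>. \<forall>z\<in>{-R..R}. (\<integral>\<^sup>+u. inv_powr a \<bar>u - z\<bar> * indicator {-R..R} u \<partial>lborel) \<le> C"
proof (intro exI conjI ballI)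
  define I where "I = (\<integral>\<^sup>+u. inv_powr a \<bar>u\<bar> * indicator {0..2*R} u \<partial>lborel)"
  have "I = (\<integral>\<^sup>+u. ennreal (u powr - a) * indicator {0..2*R} u \<partial>lborel)"
    unfolding I_def
    by (intro nn_integral_cong_AE eventually_mono[OF AE_lborel_singleton[of 0]])
      (auto simp: inv_powr_pos split: split_indicator)
  also have "\<dots> = ennreal ((2*R) powr (- a + 1) / (- a + 1))"
    using a R by (intro nn_integral_has_integral_lebesgue' has_integral_powr_from_0) auto
  finally show "2 * I < \<infinity>" by (simp add: ennreal_mult_less_top)
  fix z assume z: "z \<in> {-R..R}"
  have "(\<integral>\<^sup>+u. inv_powr a \<bar>u - z\<bar> * indicator {-R..R} u \<partial>lborel) =
      (\<integral>\<^sup>+u. inv_powr a \<bar>u\<bar> * indicator {-R..R} (z + u) \<partial>lborel)"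
    by (subst nn_integral_real_affine[where c = 1 and t = z]) auto
  also have "\<dots> \<le> (\<integral>\<^sup>+u. inv_powr a \<bar>u\<bar> * indicator {0..2*R} u + inv_powr a \<bar>u\<bar> * indicator {0..2*R} (- u) \<partial>lborel)"
    using z by (intro nn_integral_mono) (auto split: split_indicator)
  also have "\<dots> = I + (\<integral>\<^sup>+u. inv_powr a \<bar>u\<bar> * indicator {0..2*R} (- u) \<partial>lborel)"
    unfolding I_def by (intro nn_integral_add) auto
  also have "(\<integral>\<^sup>+u. inv_powr a \<bar>u\<bar> * indicator {0..2*R} (- u) \<partial>lborel) = I"
    unfolding I_def by (subst nn_integral_real_affine[where c = "-1" and t = 0]) auto
  finally show "(\<integral>\<^sup>+u. inv_powr a \<bar>u - z\<bar> * indicator {-R..R} u \<partial>lborel) \<le> 2 * I"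
    by (simp add: mult_2)
qed

text \<open>
  Since \<open>\<bar>x \<bullet> b\<bar> \<le> \<parallel>x\<parallel>\<close> for each of the \<open>DIM('a)\<close> basis vectors \<open>b\<close>, the power of the norm is at most
  a product of one-dimensional powers, and polar coordinates are not needed.
\<close>

lemma inv_powr_integral_bound:
  assumes a: "0 < a" "a < 1" and R: "0 \<le> R"
  shows "\<exists>C<\<infinity>. \<forall>z\<in>cball (0::'a::euclidean_space) R.
    (\<integral>\<^sup>+x. inv_powr (real DIM('a) * a) (norm (x - z)) * indicator (cball 0 R) x \<partial>lborel) \<le> C"
proof -
  obtain C where C: "C < \<infinity>"
    "\<And>z. z \<in> {-R..R} \<Longrightarrow> (\<integral>\<^sup>+u. inv_powr a \<bar>u - z\<bar> * indicator {-R..R} u \<partial>lborel) \<le> C"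
    using inv_powr_integral_bound_real[OF assms] by blast
  show ?thesis
  proof (intro exI conjI ballI)
    show "C ^ DIM('a) < \<infinity>" using C(1) by (simp add: power_less_top_ennreal)
    fix z :: 'a assume z: "z \<in> cball 0 R"
    have comp: "x \<bullet> b \<in> {-R..R}" if "x \<in> cball 0 R" "b \<in> Basis" for x b :: 'a
      using Basis_le_norm[OF that(2), of x] that(1) by auto
    have "(\<integral>\<^sup>+x. inv_powr (real DIM('a) * a) (norm (x - z)) * indicator (cball 0 R) x \<partial>lborel) \<le>
        (\<integral>\<^sup>+x. (\<Prod>b\<in>Basis. inv_powr a \<bar>x \<bullet> b - z \<bullet> b\<bar> * indicator {-R..R} (x \<bullet> b)) \<partial>lborel)"
    proof (intro nn_integral_mono)
      fix x :: 'a
      have "inv_powr (real DIM('a) * a) (norm (x - z)) = (\<Prod>b\<in>(Basis::'a set). inv_powr a (norm (x - z)))"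
        by (simp add: inv_powr_power)
      also have "\<dots> \<le> (\<Prod>b\<in>Basis. inv_powr a \<bar>x \<bullet> b - z \<bullet> b\<bar>)"
        using a Basis_le_norm[of _ "x - z"]
        by (intro prod_mono_ennreal inv_powr_antimono) (auto simp: inner_diff_left)
      finally show "inv_powr (real DIM('a) * a) (norm (x - z)) * indicator (cball 0 R) x \<le>
          (\<Prod>b\<in>Basis. inv_powr a \<bar>x \<bullet> b - z \<bullet> b\<bar> * indicator {-R..R} (x \<bullet> b))"
        using comp by (auto simp: prod.distrib split: split_indicator)
    qed
    also have "\<dots> = (\<Prod>b\<in>Basis. (\<integral>\<^sup>+u. inv_powr a \<bar>u - z \<bullet> b\<bar> * indicator {-R..R} u \<partial>lborel))"
      by (rule nn_integral_lborel_prod) auto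
    also have "\<dots> \<le> (\<Prod>b\<in>(Basis::'a set). C)"
      using C(2) comp[OF z] by (intro prod_mono_ennreal) auto
    finally show "(\<integral>\<^sup>+x. inv_powr (real DIM('a) * a) (norm (x - z)) * indicator (cball 0 R) x \<partial>lborel) \<le> C ^ DIM('a)"
      by simp
  qed
qed

section \<open>Integrals along the trajectory\<close>

text \<open>\<open>t0\<close> stands in for a parameter at which \<open>h\<close> is nearest to
  \<open>y\<close>. As \<open>J\<close> need not be closed and \<open>h\<close> is not assumed
  continuous, it is taken as the limit of a subsequence of a minimizing sequence and may lie outside
  \<open>J\<close>. The triangle inequality through \<open>h (s (r n))\<close> gives c |t - t0|
  \<le> |h t - y| + m, and \<open>m\<close> is at most |h t - y|; hence the factor 1/2.\<close>

lemma exists_nearest_parameter: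
  fixes h :: "real \<Rightarrow> 'a::real_normed_vector"
  assumes J: "J \<subseteq> {a..b}" "J \<noteq> {}" and c: "0 \<le> c"
    and exp: "\<And>s t. s \<in> J \<Longrightarrow> t \<in> J \<Longrightarrow> c * \<bar>t - s\<bar> \<le> norm (h t - h s)"
  shows "\<exists>t0\<in>{a..b}. \<forall>t\<in>J. c / 2 * \<bar>t - t0\<bar> \<le> norm (h t - y)"
proof -
  define m where "m = (INF t\<in>J. norm (h t - y))"
  have bdd: "bdd_below ((\<lambda>t. norm (h t - y)) ` J)" by (rule bdd_belowI2[of _ 0]) simp
  have m: "m \<le> norm (h t - y)" if "t \<in> J" for t
    unfolding m_def using bdd that by (rule cINF_lower)
  have "\<exists>t\<in>J. norm (h t - y) < m + inverse (real (Suc n))" for n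
  proof -
    have "m < m + inverse (real (Suc n))" by simp
    then show ?thesis unfolding m_def using cINF_less_iff[OF J(2) bdd] by blast
  qed
  then obtain s where s: "\<And>n. s n \<in> J" "\<And>n. norm (h (s n) - y) < m + inverse (real (Suc n))"
    by metis
  obtain t0 r where t0: "t0 \<in> {a..b}" and r: "strict_mono r" and lim: "(s \<circ> r) \<longlonglongrightarrow> t0"
    using compact_Icc[of a b] s(1) J(1) unfolding compact_def by (metis subsetD)
  show ?thesis
  proof (intro bexI[OF _ t0] ballI)
    fix t assume t: "t \<in> J"
    have le: "c * \<bar>t - (s \<circ> r) n\<bar> \<le> norm (h t - y) + (m + inverse (real (Suc (r n))))" for n
    proof -
      have "c * \<bar>t - (s \<circ> r) n\<bar> \<le> norm (h t - h (s (r n)))"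
        using exp[OF s(1) t] by simp
      also have "\<dots> \<le> norm (h t - y) + norm (h (s (r n)) - y)"
        using norm_triangle_ineq4[of "h t - y" "h (s (r n)) - y"] by simp
      finally show ?thesis using s(2)[of "r n"] by linarith
    qed
    have "(\<lambda>n. c * \<bar>t - (s \<circ> r) n\<bar>) \<longlonglongrightarrow> c * \<bar>t - t0\<bar>"
      by (intro tendsto_intros lim)
    moreover have "(\<lambda>n. inverse (real (Suc (r n)))) \<longlonglongrightarrow> 0"
      using LIMSEQ_subseq_LIMSEQ[OF LIMSEQ_inverse_real_of_nat r] by (simp add: o_def)
    then have "(\<lambda>n. norm (h t - y) + (m + inverse (real (Suc (r n))))) \<longlonglongrightarrow> norm (h t - y) + (m + 0)"
      by (intro tendsto_intros)
    ultimately have "c * \<bar>t - t0\<bar> \<le> norm (h t - y) + (m + 0)"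
      by (rule LIMSEQ_le) (use le in blast)
    then show "c / 2 * \<bar>t - t0\<bar> \<le> norm (h t - y)"
      using m[OF t] by simp
  qed
qed

lemma trajectory_speed_bound:
  assumes "inverse_speed_sup T h' < \<infinity>"
  shows "\<exists>c>0. \<forall>t\<in>{0..T}. c \<le> norm (h' t)"
proof -
  obtain S where S: "inverse_speed_sup T h' = ennreal S" "0 \<le> S"
    using assms by (cases "inverse_speed_sup T h'") auto
  \<comment> \<open>\<open>S\<close> is 0 when the supremum is over an empty interval; adding 1
    keeps the resulting bound positive.\<close>
  have "inverse (S + 1) \<le> norm (h' t)" if t: "t \<in> {0..T}" for t
  proof -
    have le: "inverse (ennreal (norm (h' t))) \<le> ennreal S"
      unfolding S(1)[symmetric] inverse_speed_sup_def by (rule SUP_upper[OF t])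
    then have pos: "0 < norm (h' t)" by (cases "h' t = 0") (auto simp: top_unique)
    then have "inverse (norm (h' t)) \<le> S"
      using le S(2) by (simp add: inverse_ennreal)
    then have "inverse (norm (h' t)) \<le> S + 1" by simp
    then show ?thesis
      using pos S(2) le_imp_inverse_le[of "inverse (norm (h' t))" "S + 1"] by simp
  qed
  then show ?thesis
    using S(2) by (intro exI[of _ "inverse (S + 1)"]) auto
qed

text \<open>Uniform continuity gives a radius within which \<open>h'\<close> varies by less than
  \<open>c / 2\<close>. The linearization of \<open>h\<close> at \<open>s\<close> then has error at
  most (c/2) |t - s|, while its linear term has norm at least c |t - s|.\<close>

lemma trajectory_locally_expanding:
  assumes tr: "trajectory T h h'" and sp: "inverse_speed_sup T h' < \<infinity>"
  shows "\<exists>c>0. \<exists>r>0. \<forall>s\<in>{0<..<T}. \<forall>t\<in>{0<..<T}. \<bar>t - s\<bar> < r \<longrightarrow> c * \<bar>t - s\<bar> \<le> norm (h t - h s)"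
proof -
  obtain c where c: "c > 0" "\<And>t. t \<in> {0..T} \<Longrightarrow> c \<le> norm (h' t)"
    using trajectory_speed_bound[OF sp] by blast
  have "uniformly_continuous_on {0..T} h'"
    using tr unfolding trajectory_def by (intro compact_uniformly_continuous) auto
  then obtain r where r: "r > 0"
    "\<And>s t. s \<in> {0..T} \<Longrightarrow> t \<in> {0..T} \<Longrightarrow> dist t s < r \<Longrightarrow> dist (h' t) (h' s) < c / 2"
    unfolding uniformly_continuous_on_def using c(1) by (metis half_gt_zero)
  have "c / 2 * \<bar>t - s\<bar> \<le> norm (h t - h s)"
    if st: "s \<in> {0<..<T}" "t \<in> {0<..<T}" "\<bar>t - s\<bar> < r" for s t
  proof -
    define S where "S = {0<..<T} \<inter> ball s r"
    have "convex S" unfolding S_def by (intro convex_Int) auto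
    have sS: "s \<in> S" "t \<in> S" using st r(1) by (auto simp: S_def dist_real_def)
    have "norm (h t - h s - (t - s) *\<^sub>R h' s) \<le> norm (t - s) * (c / 2)"
    proof (rule differentiable_bound_linearization[where f' = "\<lambda>x u. u *\<^sub>R h' x" and S = S])
      show "s + u *\<^sub>R (t - s) \<in> S" if "u \<in> {0..1}" for u
        using convexD_alt[OF \<open>convex S\<close> sS, of u] that by (simp add: algebra_simps)
      show "(h has_derivative (\<lambda>u. u *\<^sub>R h' x)) (at x within S)" if "x \<in> S" for x
        using tr that unfolding trajectory_def S_def has_vector_derivative_def
        by (auto intro: has_derivative_at_withinI)
      show "onorm ((\<lambda>u. u *\<^sub>R h' x) - (\<lambda>u. u *\<^sub>R h' s)) \<le> c / 2" if "x \<in> S" for x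
      proof (rule onorm_le)
        fix u :: real
        have "norm (h' x - h' s) \<le> c / 2"
          using r(2)[of s x] that st by (simp add: S_def dist_norm norm_minus_commute abs_minus_commute)
        then have "\<bar>u\<bar> * norm (h' x - h' s) \<le> \<bar>u\<bar> * (c / 2)"
          by (rule mult_left_mono) simp
        then show "norm (((\<lambda>u. u *\<^sub>R h' x) - (\<lambda>u. u *\<^sub>R h' s)) u) \<le> c / 2 * norm u"
          by (simp add: mult.commute flip: scaleR_diff_right)
      qed
    qed (use sS in auto)
    moreover have "c * \<bar>t - s\<bar> \<le> norm ((t - s) *\<^sub>R h' s)"
      using mult_right_mono[OF c(2)[of s], of "\<bar>t - s\<bar>"] st by (simp add: mult.commute)
    moreover have "norm ((t - s) *\<^sub>R h' s) \<le> norm (h t - h s) + norm (h t - h s - (t - s) *\<^sub>R h' s)"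
      using norm_triangle_ineq4[of "h t - h s" "h t - h s - (t - s) *\<^sub>R h' s"] by simp
    ultimately show ?thesis by (simp add: mult.commute)
  qed
  then show ?thesis using c(1) r(1) by (intro exI[of _ "c / 2"]) auto
qed

text \<open>Cut the time interval into \<open>n\<close> pieces shorter than \<open>r\<close>. On
  each of them \<open>h\<close> expands distances, so |h t - y| \<ge> (c/2) |t - t0| for a suitable
  \<open>t0\<close>, which reduces the integral to the one-dimensional bound. Only the points
  \<open>t0\<close> depend on \<open>y\<close>, and that bound is uniform in them.\<close>

lemma trajectory_integral_bound:
  assumes tr: "trajectory T h h'" and sp: "inverse_speed_sup T h' < \<infinity>" and T: "0 < T"
    and a: "0 < a" "a < 1"
  shows "\<exists>C<\<infinity>. \<forall>y. (\<integral>\<^sup>+t. inv_powr a (norm (h t - y)) * indicator {0<..<T} t \<partial>lborel) \<le> C"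
proof -
  obtain c r where c: "0 < c" and r: "0 < r"
    and exp: "\<And>s t. s \<in> {0<..<T} \<Longrightarrow> t \<in> {0<..<T} \<Longrightarrow> \<bar>t - s\<bar> < r \<Longrightarrow> c * \<bar>t - s\<bar> \<le> norm (h t - h s)"
    using trajectory_locally_expanding[OF tr sp] by blast
  obtain C where C: "C < \<infinity>"
    "\<And>z. z \<in> {-T..T} \<Longrightarrow> (\<integral>\<^sup>+u. inv_powr a \<bar>u - z\<bar> * indicator {-T..T} u \<partial>lborel) \<le> C"
    using inv_powr_integral_bound_real[OF a, of T] T by auto
  obtain n :: nat where n: "T / r < real n" using reals_Archimedean2 by blast
  then have n0: "0 < n" using T r by (cases n) (auto simp: field_simps)
  define J where "J i = {0<..<T} \<inter> {real i * (T / n)..real (Suc i) * (T / n)}" for i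
  have step: "T / n < r" using n n0 r by (simp add: field_simps)
  show ?thesis
  proof (intro exI conjI allI)
    show "real n * (inv_powr a (c / 2) * C) < \<infinity>"
      using C(1) c by (simp add: inv_powr_pos ennreal_mult_less_top of_nat_less_top)
    fix y
    have "\<exists>t0\<in>{-T..T}. \<forall>t\<in>J i. c / 2 * \<bar>t - t0\<bar> \<le> norm (h t - y)" for i
    proof (cases "J i = {}")
      case True
      then show ?thesis using T by (intro bexI[of _ 0]) auto
    next
      case False
      have "\<bar>t - s\<bar> < r" if "s \<in> J i" "t \<in> J i" for s t
        using that step unfolding J_def of_nat_Suc distrib_right by (auto simp del: times_divide_eq_right)
      then show ?thesis
        using exp c T False by (intro exists_nearest_parameter) (auto simp: J_def)
    qed
    then obtain t0 where t0: "\<And>i. t0 i \<in> {-T..T}"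
      "\<And>i t. t \<in> J i \<Longrightarrow> c / 2 * \<bar>t - t0 i\<bar> \<le> norm (h t - y)" by metis
    have "(\<integral>\<^sup>+t. inv_powr a (norm (h t - y)) * indicator {0<..<T} t \<partial>lborel) \<le>
        (\<integral>\<^sup>+t. (\<Sum>i<n. inv_powr a (c / 2) * (inv_powr a \<bar>t - t0 i\<bar> * indicator {-T..T} t)) \<partial>lborel)"
    proof (intro nn_integral_mono)
      fix t
      show "inv_powr a (norm (h t - y)) * indicator {0<..<T} t \<le>
          (\<Sum>i<n. inv_powr a (c / 2) * (inv_powr a \<bar>t - t0 i\<bar> * indicator {-T..T} t))"
      proof (cases "t \<in> {0<..<T}")
        case True
        \<comment> \<open>The index of a piece that contains \<open>t\<close>.\<close>
        define i where "i = nat \<lfloor>t / (T / n)\<rfloor>"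
        have nonneg: "0 \<le> t / (T / n)" using True T by simp
        have i_le: "real i \<le> t / (T / n)" and lt_i: "t / (T / n) < real (Suc i)"
          using nonneg unfolding i_def by linarith+
        have "t / (T / n) < n" using True T n0 by (simp add: field_simps)
        then have "i < n" using i_le by linarith
        have "t \<in> J i"
          using True i_le lt_i T n0 unfolding J_def by (auto simp: field_simps)
        have "inv_powr a (norm (h t - y)) \<le> inv_powr a (c / 2 * \<bar>t - t0 i\<bar>)"
          using t0(2)[OF \<open>t \<in> J i\<close>] c a by (intro inv_powr_antimono) auto
        also have "\<dots> = inv_powr a (c / 2) * inv_powr a \<bar>t - t0 i\<bar>"
          using c by (intro inv_powr_mult) auto
        also have "\<dots> \<le> (\<Sum>i<n. inv_powr a (c / 2) * inv_powr a \<bar>t - t0 i\<bar>)"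
          using \<open>i < n\<close> by (intro member_le_sum) auto
        finally show ?thesis using True by simp
      qed simp
    qed
    also have "\<dots> = (\<Sum>i<n. inv_powr a (c / 2) * (\<integral>\<^sup>+t. inv_powr a \<bar>t - t0 i\<bar> * indicator {-T..T} t \<partial>lborel))"
      by (simp add: nn_integral_sum nn_integral_cmult)
    also have "\<dots> \<le> (\<Sum>i<n. inv_powr a (c / 2) * C)"
      using C(2) t0(1) by (intro sum_mono mult_left_mono) auto
    finally show "(\<integral>\<^sup>+t. inv_powr a (norm (h t - y)) * indicator {0<..<T} t \<partial>lborel) \<le> real n * (inv_powr a (c / 2) * C)"
      by (simp add: ennreal_of_nat_eq_real_of_nat)
  qed
qed

section \<open>Square integrability of the Gram kernel for the singular kernel\<close>

lemma trajectory_continuous_on: "trajectory T h h' \<Longrightarrow> continuous_on {0<..<T} h"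
  unfolding trajectory_def
  by (meson continuous_at_imp_continuous_on has_vector_derivative_continuous)

lemma nn_integral_lebesgue_on:
  assumes "S \<in> sets lebesgue"
  shows "(\<integral>\<^sup>+x. f x \<partial>lebesgue_on S) = (\<integral>\<^sup>+x. f x * indicator S x \<partial>lborel)"
  using assms by (simp add: nn_integral_restrict_space nn_integral_completion)

text \<open>After \<open>nn_integral_gram_swap\<close> it remains to bound the Gram kernel in the
  time variables. \<open>product_bound\<close> with \<open>d = 1 / 4\<close> lowers the critical
  exponent 2p, the dimension, to an integrable one; the price |h s - h t|^(-1/4) is still integrable
  along the trajectory after squaring.\<close>

lemma singular_kernel_gram_finite:
  fixes D :: "(real ^ 'd) set" and G :: "real ^ 'd ^ 'd"
  assumes D: "open D" "bounded D" and T: "0 < T" and G: "invertible G"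
    and tr: "trajectory T h h'" and sp: "inverse_speed_sup T h' < \<infinity>"
    and hD: "\<forall>t\<in>{0<..<T}. matrix_inv G *v h t \<in> D"
  shows "square_integrable_gram (lebesgue_on D) (lebesgue_on {0<..<T}) (singular_kernel G h)"
proof -
  define M where "M = lebesgue_on D"
  define N where "N = lebesgue_on {0<..<T}"
  define p where "p = real CARD('d) / 2"
  have D_lm: "D \<in> lmeasurable" using D by (intro lmeasurable_open)
  have "finite_measure M" "finite_measure N"
    unfolding M_def N_def using D_lm by (auto intro!: finite_measure_lebesgue_on)
  interpret fM: finite_measure M by fact
  interpret fN: finite_measure N by fact
  interpret pair_sigma_finite M N ..
  have space: "space M = D" "space N = {0<..<T}"
    by (auto simp: M_def N_def space_restrict_space)
  have [measurable]: "(\<lambda>x. G *v x) \<in> borel_measurable M"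
    unfolding M_def using D_lm
    by (intro continuous_imp_measurable_on_sets_lebesgue) (auto intro: continuous_intros matrix_vector_mult_linear_continuous_on)
  have [measurable]: "h \<in> borel_measurable N"
    unfolding N_def by (intro continuous_imp_measurable_on_sets_lebesgue trajectory_continuous_on[OF tr]) auto
  have k_meas [measurable]: "case_prod (singular_kernel G h) \<in> borel_measurable (M \<Otimes>\<^sub>M N)"
    unfolding singular_kernel_def by measurable
  have kernel_eq: "singular_kernel G h x t = norm (G *v x - h t) powr - p" for x t
    by (simp add: singular_kernel_def p_def)
  have p: "1 / 2 \<le> p" by (simp add: p_def Suc_le_eq)
  obtain R where R: "0 < R" "D \<subseteq> cball 0 R"
    using D(2) bounded_subset_cball by (metis bounded_pos mem_cball_0 subsetI)
  \<comment> \<open>Chosen so that the dimension times \<open>a\<close> equals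
    \<open>2 * p - 1 / 4\<close>, the exponent that \<open>product_bound\<close> leaves for the
    space integral.\<close>
  define a where "a = 1 - 1 / (4 * real CARD('d))"
  have card: "1 \<le> real CARD('d)" by (simp add: Suc_le_eq)
  have "1 / (4 * real CARD('d)) < 1"
    by (subst divide_less_eq_1_pos) (use card in linarith)+
  then have a: "0 < a" "a < 1" and pa: "2 * p - 1 / 4 = real DIM(real ^ 'd) * a"
    by (simp_all add: a_def p_def right_diff_distrib)
  obtain C where C: "C < \<infinity>" "\<And>z. z \<in> cball (0 :: real ^ 'd) R \<Longrightarrow>
    (\<integral>\<^sup>+x. inv_powr (2 * p - 1 / 4) (norm (x - z)) * indicator (cball 0 R) x \<partial>lborel) \<le> C"
    using inv_powr_integral_bound[OF a, of R, where 'a = "real ^ 'd"] R(1) unfolding pa by auto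
  obtain B where B: "0 < B" "\<And>w. norm (matrix_inv G *v w) \<le> norm w * B"
    using bounded_linear.pos_bounded[OF matrix_vector_mul_bounded_linear[of "matrix_inv G"]] by blast
  have Ginv: "matrix_inv G ** G = mat 1"
    using someI_ex[OF G[unfolded invertible_def]] by (simp add: matrix_inv_def)
  \<comment> \<open>The factor comes from |x - z| \<le> B |G x - h t| with z = G^(-1) h t: the
    linear map is removed by comparing norms instead of changing variables.\<close>
  define C' where "C' = inv_powr (2 * p - 1 / 4) (inverse B) * C"
  have C'_fin: "C' < \<infinity>"
    using C(1) B(1) by (simp add: C'_def inv_powr_pos ennreal_mult_less_top)
  have C': "(\<integral>\<^sup>+x. inv_powr (2 * p - 1 / 4) (norm (G *v x - h t)) \<partial>M) \<le> C'" if t: "t \<in> {0<..<T}" for t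
  proof -
    define z where "z = matrix_inv G *v h t"
    have "norm (x - z) \<le> norm (G *v x - h t) * B" for x
    proof -
      have "x - z = matrix_inv G *v (G *v x - h t)"
        using Ginv
        by (simp add: z_def matrix_vector_mult_diff_distrib matrix_vector_mul_assoc)
      then show ?thesis using B(2) by simp
    qed
    then have "inverse B * norm (x - z) \<le> norm (G *v x - h t)" for x
      using B(1) by (simp add: field_simps)
    then have "inv_powr (2 * p - 1 / 4) (norm (G *v x - h t)) \<le>
        inv_powr (2 * p - 1 / 4) (inverse B) * inv_powr (2 * p - 1 / 4) (norm (x - z))" for x
      using p B(1) by (subst inv_powr_mult[symmetric]) (auto intro!: inv_powr_antimono)
    then have "(\<integral>\<^sup>+x. inv_powr (2 * p - 1 / 4) (norm (G *v x - h t)) \<partial>M) \<le>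
        (\<integral>\<^sup>+x. inv_powr (2 * p - 1 / 4) (inverse B) *
          (inv_powr (2 * p - 1 / 4) (norm (x - z)) * indicator (cball 0 R) x) \<partial>lborel)"
      unfolding M_def using D_lm R(2)
      by (subst nn_integral_lebesgue_on) (auto intro!: nn_integral_mono split: split_indicator)
    also have "\<dots> = inv_powr (2 * p - 1 / 4) (inverse B) *
        (\<integral>\<^sup>+x. inv_powr (2 * p - 1 / 4) (norm (x - z)) * indicator (cball 0 R) x \<partial>lborel)"
      by (rule nn_integral_cmult) (auto intro!: borel_measurable_times_ennreal borel_measurable_indicator)
    \<comment> \<open>By \<open>hD\<close> the singularity \<open>z\<close> lies in
      \<open>D\<close>, hence in the ball on which \<open>C\<close> is uniform.\<close>
    also have "\<dots> \<le> C'"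
      unfolding C'_def z_def by (intro mult_left_mono C(2) subsetD[OF R(2)]) (use hD t in auto)
    finally show ?thesis .
  qed
  \<comment> \<open>The exponent 1/2 is twice 1/4, since the Gram kernel enters squared; it is below
    1, as the trajectory bound requires.\<close>
  obtain E where E: "E < \<infinity>"
    "\<And>y. (\<integral>\<^sup>+t. inv_powr (1 / 2) (norm (h t - y)) * indicator {0<..<T} t \<partial>lborel) \<le> E"
    using trajectory_integral_bound[OF tr sp T, of "1 / 2"] by auto
  have gram_bound: "(\<integral>\<^sup>+x. ennreal (singular_kernel G h x t) * ennreal (singular_kernel G h x s) \<partial>M) \<le>
      inv_powr (1 / 4) (norm (h s - h t) / 2) * (2 * C')"
    if ts: "t \<in> space N" "s \<in> space N" for t s
  proof -
    have "(\<integral>\<^sup>+x. ennreal (singular_kernel G h x t) * ennreal (singular_kernel G h x s) \<partial>M) \<le>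
        (\<integral>\<^sup>+x. inv_powr (1 / 4) (norm (h s - h t) / 2) *
          (inv_powr (2 * p - 1 / 4) (norm (G *v x - h t)) + inv_powr (2 * p - 1 / 4) (norm (G *v x - h s))) \<partial>M)"
    proof (intro nn_integral_mono)
      fix x
      have "norm (h s - h t) \<le> norm (G *v x - h t) + norm (G *v x - h s)"
        using norm_triangle_ineq4[of "G *v x - h t" "G *v x - h s"] by simp
      then show "ennreal (singular_kernel G h x t) * ennreal (singular_kernel G h x s) \<le>
        inv_powr (1 / 4) (norm (h s - h t) / 2) *
          (inv_powr (2 * p - 1 / 4) (norm (G *v x - h t)) + inv_powr (2 * p - 1 / 4) (norm (G *v x - h s)))"
        using product_bound[of "norm (G *v x - h t)" "norm (G *v x - h s)" "norm (h s - h t)" "1 / 4" p] p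
        by (simp add: kernel_eq ennreal_mult')
    qed
    also have "\<dots> = inv_powr (1 / 4) (norm (h s - h t) / 2) *
        ((\<integral>\<^sup>+x. inv_powr (2 * p - 1 / 4) (norm (G *v x - h t)) \<partial>M) +
         (\<integral>\<^sup>+x. inv_powr (2 * p - 1 / 4) (norm (G *v x - h s)) \<partial>M))"
      by (simp add: nn_integral_cmult nn_integral_add)
    also have "\<dots> \<le> inv_powr (1 / 4) (norm (h s - h t) / 2) * (C' + C')"
      using ts C' by (intro mult_left_mono add_mono) (auto simp: space)
    finally show ?thesis by (simp add: mult_2)
  qed
  have "(\<integral>\<^sup>+x. \<integral>\<^sup>+y. (\<integral>\<^sup>+t. ennreal (singular_kernel G h x t * singular_kernel G h y t) \<partial>N)\<^sup>2 \<partial>M \<partial>M) =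
      (\<integral>\<^sup>+x. \<integral>\<^sup>+y. (\<integral>\<^sup>+t. ennreal (singular_kernel G h x t) * ennreal (singular_kernel G h y t) \<partial>N)\<^sup>2 \<partial>M \<partial>M)"
    by (simp add: ennreal_mult' singular_kernel_def)
  also have "\<dots> = (\<integral>\<^sup>+t. \<integral>\<^sup>+s. (\<integral>\<^sup>+x. ennreal (singular_kernel G h x t) * ennreal (singular_kernel G h x s) \<partial>M)\<^sup>2 \<partial>N \<partial>N)"
    by (rule nn_integral_gram_swap) measurable
  also have "\<dots> \<le> (\<integral>\<^sup>+t. inv_powr (1 / 2) (1 / 2) * (2 * C')\<^sup>2 * E \<partial>N)"
  proof (rule nn_integral_mono)
    fix t assume t: "t \<in> space N"
    have "(\<integral>\<^sup>+s. (\<integral>\<^sup>+x. ennreal (singular_kernel G h x t) * ennreal (singular_kernel G h x s) \<partial>M)\<^sup>2 \<partial>N) \<le>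
        (\<integral>\<^sup>+s. inv_powr (1 / 2) (1 / 2) * (2 * C')\<^sup>2 * inv_powr (1 / 2) (norm (h s - h t)) \<partial>N)"
    proof (rule nn_integral_mono)
      fix s assume s: "s \<in> space N"
      have "(\<integral>\<^sup>+x. ennreal (singular_kernel G h x t) * ennreal (singular_kernel G h x s) \<partial>M)\<^sup>2 \<le>
          (inv_powr (1 / 4) (norm (h s - h t) / 2) * (2 * C'))\<^sup>2"
        by (intro power_mono gram_bound t s) simp
      also have "\<dots> = inv_powr (1 / 2) (1 / 2 * norm (h s - h t)) * (2 * C')\<^sup>2"
        by (simp add: power_mult_distrib inv_powr_power)
      also have "\<dots> = inv_powr (1 / 2) (1 / 2) * (2 * C')\<^sup>2 * inv_powr (1 / 2) (norm (h s - h t))"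
        by (subst inv_powr_mult) (auto simp: mult_ac)
      finally show "(\<integral>\<^sup>+x. ennreal (singular_kernel G h x t) * ennreal (singular_kernel G h x s) \<partial>M)\<^sup>2 \<le>
        inv_powr (1 / 2) (1 / 2) * (2 * C')\<^sup>2 * inv_powr (1 / 2) (norm (h s - h t))" .
    qed
    also have "\<dots> = inv_powr (1 / 2) (1 / 2) * (2 * C')\<^sup>2 * (\<integral>\<^sup>+s. inv_powr (1 / 2) (norm (h s - h t)) \<partial>N)"
      by (rule nn_integral_cmult) measurable
    also have "\<dots> \<le> inv_powr (1 / 2) (1 / 2) * (2 * C')\<^sup>2 * E"
      using E(2)[of "h t"] unfolding N_def
      by (intro mult_left_mono) (simp_all add: nn_integral_lebesgue_on)
    finally show "(\<integral>\<^sup>+s. (\<integral>\<^sup>+x. ennreal (singular_kernel G h x t) * ennreal (singular_kernel G h x s) \<partial>M)\<^sup>2 \<partial>N) \<le>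
      inv_powr (1 / 2) (1 / 2) * (2 * C')\<^sup>2 * E" .
  qed
  also have "\<dots> < \<infinity>"
  proof -
    have "inv_powr (1 / 2) (1 / 2) * (2 * C')\<^sup>2 * E < \<infinity>"
      using C'_fin E(1) by (simp add: inv_powr_pos ennreal_mult_less_top power_less_top_ennreal)
    moreover have "emeasure N (space N) < \<infinity>"
      using fN.emeasure_finite[of "space N"] unfolding infinity_ennreal_def top.not_eq_extremum .
    ultimately show ?thesis
      unfolding nn_integral_const infinity_ennreal_def by (subst ennreal_mult_less_top) blast
  qed
  finally have "(\<integral>\<^sup>+x. \<integral>\<^sup>+y. (\<integral>\<^sup>+t. ennreal (singular_kernel G h x t * singular_kernel G h y t) \<partial>N)\<^sup>2 \<partial>M \<partial>M) < \<infinity>" .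
  moreover have "0 \<le> singular_kernel G h x t" for x t
    by (simp add: singular_kernel_def)
  ultimately have "square_integrable_gram M N (singular_kernel G h)"
    by (intro square_integrable_gram.intro square_integrable_gram_axioms.intro k_meas
        fM.sigma_finite_measure_axioms fN.sigma_finite_measure_axioms)
  then show ?thesis unfolding M_def N_def .
qed

section \<open>Decay of the eigenvalues for the singular kernel\<close>

theorem theorem3p3:
  fixes D :: "(real ^ 'd) set" and T :: real and G :: "real ^ 'd ^ 'd"
    and h h' :: "real \<Rightarrow> real ^ 'd" and lam :: "nat \<Rightarrow> real"
  assumes "CARD('d) \<in> {2, 3}"
    and "bounded_lipschitz_domain D"
    and "T > 0"
    and "invertible G"
    and "trajectory T h h'"
    and "inverse_speed_sup T h' < \<infinity>"
    and "\<forall>t\<in>{0<..<T}. matrix_inv G *v h t \<in> D"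
    and "\<exists>N :: nat. \<forall>x\<in>D. finite {t\<in>{0<..<T}. h t = G *v x} \<and>
           card {t\<in>{0<..<T}. h t = G *v x} \<le> N"
    and "eigenvalue_sequence (lebesgue_on D) (normal_op D {0<..<T} (singular_kernel G h)) lam"
  shows "\<forall>\<epsilon>>0. \<exists>C. \<forall>\<^sub>F n in sequentially. lam n \<le> C * real n powr (- 1 / 2 + \<epsilon>)"
proof (intro allI impI)
  fix \<epsilon> :: real assume "\<epsilon> > 0"
  have "open D" "bounded D" using assms(2) by (auto simp: bounded_lipschitz_domain_def)
  then interpret square_integrable_gram "lebesgue_on D" "lebesgue_on {0<..<T}" "singular_kernel G h"
    by (rule singular_kernel_gram_finite) (fact assms)+
  \<comment> \<open>The constant is the Hilbert-Schmidt norm of the operator. Taking the root of n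
    (lam n)^2 \<le> \<open>hs_norm_sq\<close> gives the power -1/2, and the factor n^\<epsilon> is
    at least 1 for \<open>n \<ge> 1\<close>.\<close>
  have "lam n \<le> sqrt hs_norm_sq * real n powr (- 1 / 2 + \<epsilon>)" if n: "1 \<le> n" for n
  proof -
    have "real n * (lam n)\<^sup>2 \<le> hs_norm_sq"
      using assms(9) n unfolding normal_op_def adjoint_op_def forward_op_def
      by (rule eigenvalue_sequence_bound)
    then have "(lam n)\<^sup>2 \<le> hs_norm_sq / real n" using n by (simp add: field_simps)
    then have "lam n \<le> sqrt (hs_norm_sq / real n)" by (rule real_le_rsqrt)
    also have "\<dots> = sqrt hs_norm_sq * real n powr (- 1 / 2)"
      using powr_minus_divide[of "real n" "1 / 2"] by (simp add: powr_half_sqrt real_sqrt_divide)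
    also have "\<dots> \<le> sqrt hs_norm_sq * real n powr (- 1 / 2 + \<epsilon>)"
      using n \<open>\<epsilon> > 0\<close> by (intro mult_left_mono powr_mono) (auto simp: hs_norm_sq_def)
    finally show ?thesis .
  qed
  then show "\<exists>C. \<forall>\<^sub>F n in sequentially. lam n \<le> C * real n powr (- 1 / 2 + \<epsilon>)"
    by (intro exI[of _ "sqrt hs_norm_sq"] eventually_sequentiallyI[of 1])
qed

end
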